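(* Let $\mathbb{F}$ be a field of positive characteristic $p$, and let $R$ be an associative $\mathbb{F}$-algebra with $R=R_1+R_2$, where $R_1,R_2$ are subalgebras of $R$ that are PI-algebras. Let $R_1$ and $R_2$ satisfy the symmetric identities of degrees $d_1$ and $d_2$, respectively. Assume that there exist an integer $k>0$ and subalgebras $L_1\subset R_1$ and $L_2\subset R_2$ of finite codimensions $t_1=\dim_{\mathbb{F}} R_1/L_1$ and $t_2=\dim_{\mathbb{F}} R_2/L_2$ such that $(L_1L_2)^k$ is a subset of $R_i$ for $i=1$ or $i=2$. Then, for this $i$, $R$ satisfies the symmetric identity of degree $$D=(d_1+d_2-2)(k d_i+2)\big((t_1+t_2)(p-1)+1\big).$$
   Context: Algebras are associative and need not have a unity. $R=R_1+R_2$ means that every element of $R$ is of the form $r_1+r_2$ with $r_1\in R_1$, $r_2\in R_2$ (the sum need not be direct). A PI-algebra is an algebra satisfying a non-zero polynomial identity with coefficients in $\mathbb{F}$ in non-commuting variables. The symmetric polynomial of degree $d$ is $s_d(x_1,\ldots,x_d)=\sum_{\sigma\in S_d}x_{\sigma(1)}\cdots x_{\sigma(d)}$ in non-commuting variables, where $S_d$ is the symmetric group on $d$ letters. An algebra $A$ satisfies the symmetric identity of degree $d$ if $s_d(a_1,\ldots,a_d)=0$ for all $a_1,\ldots,a_d\in A$. For subsets $A,B$ of an algebra, $(AB)^k$ denotes the set of all products $a_1b_1a_2b_2\cdots a_kb_k$ with $a_j\in A$, $b_j\in B$. *)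

theory Defs
  imports Complex_Main "HOL-Library.Poly_Mapping" "HOL-Combinatorics.Permutations"
begin

(* The type class ring does not assume a unity, so algebras here need not be unital. *)
locale assoc_algebra = vector_space scale
  for scale :: "'f::field \<Rightarrow> 'r::ring \<Rightarrow> 'r" +
  assumes mult_scale_left: "scale c x * y = scale c (x * y)"
    and mult_scale_right: "x * scale c y = scale c (x * y)"

definition subalgebra :: "('f::field \<Rightarrow> 'r::ring \<Rightarrow> 'r) \<Rightarrow> 'r set \<Rightarrow> bool" where
  "subalgebra scale A \<longleftrightarrow>
     module.subspace scale A \<and> (\<forall>x\<in>A. \<forall>y\<in>A. x * y \<in> A)"

(* Without a unity the empty product has no meaning; its value 0 is a dummy. *)
fun word_prod :: "'r::ring list \<Rightarrow> 'r" where
  "word_prod [] = 0"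
| "word_prod [x] = x"
| "word_prod (x # y # zs) = x * word_prod (y # zs)"

(* A polynomial in the non-commuting variables x_0, x_1, ... is a finitely supported
   family of coefficients indexed by words: the list [i, j, ...] is the monomial
   x_i x_j .... *)
definition poly_eval ::
  "('f::field \<Rightarrow> 'r::ring \<Rightarrow> 'r) \<Rightarrow> (nat list \<Rightarrow>\<^sub>0 'f) \<Rightarrow> (nat \<Rightarrow> 'r) \<Rightarrow> 'r" where
  "poly_eval scale f a =
     (\<Sum>w\<in>Poly_Mapping.keys f. scale (Poly_Mapping.lookup f w) (word_prod (map a w)))"

(* As algebras need not have a unity, identities are taken in the free algebra without
   unity, that is, their constant term is 0. *)
definition PI_algebra :: "('f::field \<Rightarrow> 'r::ring \<Rightarrow> 'r) \<Rightarrow> 'r set \<Rightarrow> bool" where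
  "PI_algebra scale A \<longleftrightarrow>
     (\<exists>f. f \<noteq> 0 \<and> Poly_Mapping.lookup f [] = 0 \<and>
          (\<forall>a. (\<forall>n. a n \<in> A) \<longrightarrow> poly_eval scale f a = 0))"

definition symmetric_poly :: "nat \<Rightarrow> (nat \<Rightarrow> 'r::ring) \<Rightarrow> 'r" where
  "symmetric_poly d a =
     (\<Sum>\<sigma> | \<sigma> permutes {1..d}. word_prod (map (\<lambda>j. a (\<sigma> j)) [1..<Suc d]))"

(* Degree 0: s_0 is the empty product, and the identity 1 = 0 holds in the zero algebra
   only. *)
definition satisfies_symmetric_identity :: "nat \<Rightarrow> 'r::ring set \<Rightarrow> bool" where
  "satisfies_symmetric_identity d A \<longleftrightarrow>
     (if d = 0 then A \<subseteq> {0}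
      else \<forall>a. (\<forall>j\<in>{1..d}. a j \<in> A) \<longrightarrow> symmetric_poly d a = 0)"

(* The set (AB)^k of all products a_1 b_1 ... a_k b_k; it is used for k > 0 only. *)
definition alternating_products :: "'r::ring set \<Rightarrow> 'r set \<Rightarrow> nat \<Rightarrow> 'r set" where
  "alternating_products A B k =
     {word_prod (concat (map (\<lambda>j. [a j, b j]) [1..<Suc k])) | a b.
        (\<forall>j\<in>{1..k}. a j \<in> A) \<and> (\<forall>j\<in>{1..k}. b j \<in> B)}"

(* The cosets b + L with b in B are pairwise distinct and form a basis of V / L. *)
definition quotient_basis ::
  "('f::field \<Rightarrow> 'r::ring \<Rightarrow> 'r) \<Rightarrow> 'r set \<Rightarrow> 'r set \<Rightarrow> 'r set \<Rightarrow> bool" where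
  "quotient_basis scale V L B \<longleftrightarrow>
     finite B \<and> B \<subseteq> V \<and>
     (\<forall>c. (\<Sum>b\<in>B. scale (c b) b) \<in> L \<longrightarrow> (\<forall>b\<in>B. c b = 0)) \<and>
     (\<forall>x\<in>V. \<exists>c. x - (\<Sum>b\<in>B. scale (c b) b) \<in> L)"

definition has_codimension ::
  "('f::field \<Rightarrow> 'r::ring \<Rightarrow> 'r) \<Rightarrow> 'r set \<Rightarrow> 'r set \<Rightarrow> nat \<Rightarrow> bool" where
  "has_codimension scale V L t \<longleftrightarrow> (\<exists>B. quotient_basis scale V L B \<and> card B = t)"

end

(* Adjoin commuting central variables e_i with e_i^2 = 0. An algebra A satisfies s_d iff every
   series over A without constant term in these variables has d-th power 0, so that x^D = 0 has
   to be proved for x = sum_i e_i a_i. Write x = y + sum_j w_j b_j, where y = P + Q with P over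
   L1 and Q over L2, the b_j represent bases of R1/L1 and R2/L2, and the w_j are linear in the e_i.
   In characteristic p every w_j^p vanishes, so the ideal generated by the w_j is nilpotent of
   index (t1 + t2)(p - 1) + 1, and x^M lies in it as soon as y^M = 0. Finally,
   y^M is the component of degree M of (1 - y)^-1, which is a polynomial of degree at most
   k d_i (d1 + d2 - 2): it is expressed by (1 - P)^-1 and (1 - Q)^-1, where P^d1 = Q^d2 = 0, and
   by powers of g = ((1 - P)^-1 - 1) ((1 - Q)^-1 - 1). As g^k has its coefficients in R_i, the
   power g^(k d_i) is 0. *)
theory Submission
  imports Defs "HOL-Library.Disjoint_Sets" "HOL-Combinatorics.Multiset_Permutations"
begin

subsection \<open>Square-free power series\<close>

text \<open>The product \<open>m\<close> is a parameter because the same convolution serves for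
  products of series, for the action of scalar series, and for that action written on the other
  side.\<close>

definition subset_conv ::
  "('a \<Rightarrow> 'b \<Rightarrow> 'c::comm_monoid_add) \<Rightarrow> (nat set \<Rightarrow> 'a) \<Rightarrow> (nat set \<Rightarrow> 'b) \<Rightarrow> nat set \<Rightarrow> 'c"
  where "subset_conv m f g S = (\<Sum>T\<in>Pow S. m (f T) (g (S - T)))"

lemma subset_conv_infinite: "infinite S \<Longrightarrow> subset_conv m f g S = 0"
  by (simp add: subset_conv_def)

text \<open>Both sides sum over the ways to cut \<open>S\<close> into three labelled disjoint
  pieces, either as U inside T inside \<open>S\<close> or as U followed by V inside
  \<open>S - U\<close>. Four products are allowed so that associativity of the ring and the
  compatibilities of scalars with products are all instances.\<close>

lemma subset_conv_assoc:
  assumes m1: "\<And>a b c. m1 (a + b) c = m1 a c + m1 b c" "\<And>c. m1 0 c = 0"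
    and m3: "\<And>a b c. m3 a (b + c) = m3 a b + m3 a c" "\<And>a. m3 a 0 = 0"
    and assoc: "\<And>a b c. m1 (m2 a b) c = m3 a (m4 b c)"
  shows "subset_conv m1 (subset_conv m2 f g) h = subset_conv m3 f (subset_conv m4 g h)"
proof
  fix S :: "nat set"
  show "subset_conv m1 (subset_conv m2 f g) h S = subset_conv m3 f (subset_conv m4 g h) S"
  proof (cases "finite S")
    case False
    then show ?thesis by (simp add: subset_conv_infinite)
  next
    case True
    have l: "m1 (sum F A) c = (\<Sum>x\<in>A. m1 (F x) c)" for F c and A :: "nat set set"
      using sum_comp_morphism[of "\<lambda>x. m1 x c" F A] m1 by (simp add: o_def)
    have r: "m3 c (sum F A) = (\<Sum>x\<in>A. m3 c (F x))" for F c and A :: "nat set set"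
      using sum_comp_morphism[of "\<lambda>x. m3 c x" F A] m3 by (simp add: o_def)
    have fin: "finite T" if "T \<subseteq> S" for T
      using that True by (rule finite_subset)
    have "subset_conv m1 (subset_conv m2 f g) h S =
        (\<Sum>T\<in>Pow S. \<Sum>U\<in>Pow T. m1 (m2 (f U) (g (T - U))) (h (S - T)))"
      by (simp add: subset_conv_def l)
    also have "\<dots> = (\<Sum>(T, U)\<in>Sigma (Pow S) Pow. m1 (m2 (f U) (g (T - U))) (h (S - T)))"
      by (rule sum.Sigma) (use True fin in auto)
    also have "\<dots> = (\<Sum>(U, V)\<in>(SIGMA U:Pow S. Pow (S - U)). m3 (f U) (m4 (g V) (h (S - U - V))))"
      by (rule sum.reindex_bij_witness[of _ "\<lambda>(U, V). (U \<union> V, U)" "\<lambda>(T, U). (U, T - U)"])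
         (auto simp: assoc intro!: arg_cong2[where f=m3] arg_cong2[where f=m4] arg_cong[where f=g] arg_cong[where f=h])
    also have "\<dots> = (\<Sum>U\<in>Pow S. \<Sum>V\<in>Pow (S - U). m3 (f U) (m4 (g V) (h (S - U - V))))"
      by (rule sum.Sigma[symmetric]) (use True in auto)
    also have "\<dots> = subset_conv m3 f (subset_conv m4 g h) S"
      by (simp add: subset_conv_def r)
    finally show ?thesis .
  qed
qed

lemma subset_conv_commute: "subset_conv m f g = subset_conv (\<lambda>a b. m b a) g f"
proof
  fix S
  show "subset_conv m f g S = subset_conv (\<lambda>a b. m b a) g f S"
    unfolding subset_conv_def
    by (rule sum.reindex_bij_witness[of _ "\<lambda>T. S - T" "\<lambda>T. S - T"])
       (auto simp: double_diff)
qed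

text \<open>
  \<open>'a sqfree\<close> is the algebra of power series over \<open>'a\<close> in commuting central variables
  \<open>\<epsilon>\<^sub>0, \<epsilon>\<^sub>1, \<dots>\<close> with \<open>\<epsilon>\<^sub>i\<^sup>2 = 0\<close>: a set \<open>S\<close> stands for the monomial \<open>\<Prod>i\<in>S. \<epsilon>\<^sub>i\<close>.
  The sum defining a product is 0 by convention when \<open>S\<close> is infinite, which is harmless.
\<close>
datatype 'a sqfree = Sqfree (coeff: "nat set \<Rightarrow> 'a")

lemma sqfree_eqI: "(\<And>S. coeff f S = coeff g S) \<Longrightarrow> f = g"
  by (cases f, cases g) auto

instantiation sqfree :: (ring) ring
begin

definition "0 = Sqfree (\<lambda>S. 0)"
definition "f + g = Sqfree (\<lambda>S. coeff f S + coeff g S)"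
definition "f - g = Sqfree (\<lambda>S. coeff f S - coeff g S)"
definition "- f = Sqfree (\<lambda>S. - coeff f S)"
definition "f * g = Sqfree (subset_conv (*) (coeff f) (coeff g))"

instance
proof
  fix f g h :: "'a sqfree"
  show "f * g * h = f * (g * h)"
    by (simp add: times_sqfree_def, rule subset_conv_assoc) (simp_all add: algebra_simps)
qed (auto intro!: sqfree_eqI sum.cong simp: zero_sqfree_def plus_sqfree_def minus_sqfree_def
      uminus_sqfree_def times_sqfree_def subset_conv_def algebra_simps sum.distrib)

end

lemma coeff_simps [simp]:
  "coeff 0 S = 0" "coeff (f + g) S = coeff f S + coeff g S"
  "coeff (f - g) S = coeff f S - coeff g S" "coeff (- f) S = - coeff f S"
  by (simp_all add: zero_sqfree_def plus_sqfree_def minus_sqfree_def uminus_sqfree_def)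

lemma coeff_mult: "coeff (f * g) S = (\<Sum>T\<in>Pow S. coeff f T * coeff g (S - T))"
  by (simp add: times_sqfree_def subset_conv_def)

lemma coeff_sum: "coeff (sum F A) S = (\<Sum>x\<in>A. coeff (F x) S)"
  by (induction A rule: infinite_finite_induct) auto

text \<open>Without a unity there is no power 0: \<open>rpow x n\<close> is \<open>x\<^sup>n\<^sup>+\<^sup>1\<close>.\<close>
primrec rpow :: "'a::ring \<Rightarrow> nat \<Rightarrow> 'a" where
  "rpow x 0 = x"
| "rpow x (Suc n) = x * rpow x n"

lemma rpow_mult: "rpow x m * rpow x n = rpow x (Suc (m + n))"
  by (induction m) (simp_all add: mult.assoc)

lemma rpow_rpow: "rpow (rpow x m) n = rpow x (Suc m * Suc n - 1)"
  by (induction n) (simp_all add: rpow_mult algebra_simps)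

lemma rpow_eq_0_mono:
  assumes "rpow x m = 0" "m \<le> n"
  shows "rpow x n = 0"
  using assms(2,1) by (induction rule: dec_induct) auto

subsection \<open>Symmetric identities and nilpotence\<close>

text \<open>Blocks of a \<open>partition_on\<close> are nonempty, which matches series without
  constant term.\<close>

definition ordered_partitions :: "nat \<Rightarrow> 'a set \<Rightarrow> 'a set list set" where
  "ordered_partitions d S = {Bs. length Bs = d \<and> distinct Bs \<and> partition_on S (set Bs)}"

lemma finite_ordered_partitions: "finite S \<Longrightarrow> finite (ordered_partitions d S)"
  by (rule finite_subset[OF _ finite_lists_length_eq[of "Pow S" d]])
     (auto simp: ordered_partitions_def partition_on_def)

lemma partition_on_Cons_iff:
  "distinct (T # Bs) \<and> partition_on S (set (T # Bs)) \<longleftrightarrow>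
    T \<subseteq> S \<and> T \<noteq> {} \<and> distinct Bs \<and> partition_on (S - T) (set Bs)"
proof
  assume *: "distinct (T # Bs) \<and> partition_on S (set (T # Bs))"
  then have "disjnt T (\<Union> (set Bs))"
    by (auto simp: partition_on_def disjoint_def disjnt_def)
  from partition_on_insert[OF this, of S] * show
    "T \<subseteq> S \<and> T \<noteq> {} \<and> distinct Bs \<and> partition_on (S - T) (set Bs)" by simp
next
  assume *: "T \<subseteq> S \<and> T \<noteq> {} \<and> distinct Bs \<and> partition_on (S - T) (set Bs)"
  then have "disjnt T (\<Union> (set Bs))" and "T \<notin> set Bs"
    by (auto simp: partition_on_def disjnt_def)
  with partition_on_insert[of T "set Bs" S] * show
    "distinct (T # Bs) \<and> partition_on S (set (T # Bs))" by simp
qed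

text \<open>Expanding the power distributes the variables in \<open>S\<close> over the factors. By
  \<open>f0\<close> no factor receives the empty set, so exactly the ordered partitions contribute;
  the induction splits off the first block.\<close>

lemma coeff_rpow:
  assumes "finite S" and f0: "coeff f {} = 0"
  shows "coeff (rpow f n) S = (\<Sum>Bs\<in>ordered_partitions (Suc n) S. word_prod (map (coeff f) Bs))"
  using assms(1)
proof (induction n arbitrary: S)
  case 0
  have "ordered_partitions (Suc 0) S = (if S = {} then {} else {[S]})"
    by (auto simp: ordered_partitions_def length_Suc_conv partition_on_def)
  then show ?case using f0 by simp
next
  case (Suc n)
  have "coeff (rpow f (Suc n)) S = (\<Sum>T\<in>Pow S - {{}}. coeff f T * coeff (rpow f n) (S - T))"
    using Suc.prems f0 by (simp add: coeff_mult, intro sum.mono_neutral_right) auto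
  also have "\<dots> = (\<Sum>T\<in>Pow S - {{}}. \<Sum>Bs\<in>ordered_partitions (Suc n) (S - T).
      coeff f T * word_prod (map (coeff f) Bs))"
    using Suc by (intro sum.cong) (auto simp: sum_distrib_left)
  also have "\<dots> = (\<Sum>(T, Bs)\<in>(SIGMA T:Pow S - {{}}. ordered_partitions (Suc n) (S - T)).
      coeff f T * word_prod (map (coeff f) Bs))"
    by (rule sum.Sigma) (use Suc.prems in \<open>auto intro: finite_ordered_partitions\<close>)
  also have "\<dots> = (\<Sum>Bs\<in>ordered_partitions (Suc (Suc n)) S. word_prod (map (coeff f) Bs))"
  proof (rule sum.reindex_bij_witness[of _ "\<lambda>Bs. (hd Bs, tl Bs)" "\<lambda>(T, Bs). T # Bs"])
    fix Bs assume "Bs \<in> ordered_partitions (Suc (Suc n)) S"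
    then obtain T Cs where "Bs = T # Cs" "length Cs = Suc n"
      "distinct (T # Cs) \<and> partition_on S (set (T # Cs))"
      by (auto simp: ordered_partitions_def length_Suc_conv)
    then show "(case (hd Bs, tl Bs) of (T, Bs) \<Rightarrow> T # Bs) = Bs"
      and "(hd Bs, tl Bs) \<in> (SIGMA T:Pow S - {{}}. ordered_partitions (Suc n) (S - T))"
      using partition_on_Cons_iff[of T Cs S] by (auto simp: ordered_partitions_def)
  next
    fix X assume "X \<in> (SIGMA T:Pow S - {{}}. ordered_partitions (Suc n) (S - T))"
    then obtain T Bs where X: "X = (T, Bs)" "T \<subseteq> S" "T \<noteq> {}" "length Bs = Suc n" "distinct Bs"
      "partition_on (S - T) (set Bs)"
      by (auto simp: ordered_partitions_def)
    then show "(case X of (T, Bs) \<Rightarrow> T # Bs) \<in> ordered_partitions (Suc (Suc n)) S"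
      using partition_on_Cons_iff[of T Bs S] by (auto simp: ordered_partitions_def)
    from X show "(hd (case X of (T, Bs) \<Rightarrow> T # Bs), tl (case X of (T, Bs) \<Rightarrow> T # Bs)) = X" by simp
    from X show "word_prod (map (coeff f) (case X of (T, Bs) \<Rightarrow> T # Bs)) =
        (case X of (T, Bs) \<Rightarrow> coeff f T * word_prod (map (coeff f) Bs))"
      by (cases Bs) auto
  qed
  finally show ?case .
qed

text \<open>Links the sum over orderings of a set of blocks to the symmetric polynomial. The shift
  \<open>j - 1\<close> arises because permutations act on \<open>{1..d}\<close> while list positions
  start at 0.\<close>

lemma sum_permutations_of_set:
  assumes "distinct xs" "length xs = d"
  shows "(\<Sum>ys\<in>permutations_of_set (set xs). word_prod (map F ys)) =
    symmetric_poly d (\<lambda>j. F (xs ! (j - 1)))"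
proof -
  define \<phi> where "\<phi> = (\<lambda>\<sigma>. map (\<lambda>j. xs ! (\<sigma> j - 1)) [1..<Suc d])"
  have r: "\<sigma> j \<in> {1..d}" if "\<sigma> permutes {1..d}" "j \<in> {1..d}" for \<sigma> j
    using permutes_in_image[OF that(1)] that(2) by blast
  have inj: "inj_on \<phi> {\<sigma>. \<sigma> permutes {1..d}}"
  proof (rule inj_onI, rule ext)
    fix \<sigma> \<tau> j
    assume *: "\<sigma> \<in> {\<sigma>. \<sigma> permutes {1..d}}" "\<tau> \<in> {\<sigma>. \<sigma> permutes {1..d}}" "\<phi> \<sigma> = \<phi> \<tau>"
    show "\<sigma> j = \<tau> j"
    proof (cases "j \<in> {1..d}")
      case True
      then have "xs ! (\<sigma> j - 1) = xs ! (\<tau> j - 1)"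
        using *(3) by (auto simp: \<phi>_def)
      moreover have "\<sigma> j \<in> {1..d}" "\<tau> j \<in> {1..d}"
        using * True r by auto
      ultimately show ?thesis
        using assms by (auto simp: nth_eq_iff_index_eq)
    next
      case False
      then show ?thesis using * by (auto simp: permutes_def)
    qed
  qed
  have "\<phi> \<sigma> \<in> permutations_of_set (set xs)" if \<sigma>: "\<sigma> permutes {1..d}" for \<sigma>
  proof -
    have *: "inj_on (\<lambda>j. xs ! (\<sigma> j - 1)) {1..d}"
    proof (rule inj_onI)
      fix i j assume ij: "i \<in> {1..d}" "j \<in> {1..d}" "xs ! (\<sigma> i - 1) = xs ! (\<sigma> j - 1)"
      with r[OF \<sigma>, of i] r[OF \<sigma>, of j] assms have "\<sigma> i = \<sigma> j"
        by (auto simp: nth_eq_iff_index_eq)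
      then show "i = j" using permutes_inj[OF \<sigma>] by (simp add: inj_eq)
    qed
    then have d: "distinct (\<phi> \<sigma>)"
      by (simp add: \<phi>_def distinct_map atLeastLessThanSuc_atLeastAtMost del: upt_Suc)
    have "set (\<phi> \<sigma>) \<subseteq> set xs"
      using r[OF \<sigma>] assms by (fastforce simp: \<phi>_def)
    moreover have "card (set (\<phi> \<sigma>)) = card (set xs)"
      using distinct_card[OF d] distinct_card[OF assms(1)] assms(2) by (simp add: \<phi>_def)
    ultimately have "set (\<phi> \<sigma>) = set xs"
      by (simp add: card_subset_eq)
    with d show ?thesis by (simp add: permutations_of_set_def)
  qed
  then have "\<phi> ` {\<sigma>. \<sigma> permutes {1..d}} \<subseteq> permutations_of_set (set xs)" by auto
  \<comment> \<open>Surjectivity of \<open>\<phi>\<close> comes from counting: both sets have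
    \<open>fact d\<close> elements.\<close>
  moreover have "card (\<phi> ` {\<sigma>. \<sigma> permutes {1..d}}) = card (permutations_of_set (set xs))"
    using assms distinct_card[OF assms(1)] card_permutations[OF card_atLeastAtMost[of 1 d]]
    by (subst card_image[OF inj]) simp
  ultimately have "\<phi> ` {\<sigma>. \<sigma> permutes {1..d}} = permutations_of_set (set xs)"
    by (simp add: card_subset_eq)
  then have "(\<Sum>ys\<in>permutations_of_set (set xs). word_prod (map F ys)) =
      (\<Sum>\<sigma> | \<sigma> permutes {1..d}. word_prod (map F (\<phi> \<sigma>)))"
    using sum.reindex[OF inj, of "\<lambda>ys. word_prod (map F ys)"] by simp
  then show ?thesis by (simp add: symmetric_poly_def \<phi>_def o_def)
qed

text \<open>Grouping the ordered partitions by their underlying set of blocks makes each inner sum a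
  value of the symmetric polynomial.\<close>

lemma coeff_rpow_partitions:
  assumes "finite S" and "coeff f {} = 0"
  shows "coeff (rpow f n) S =
    (\<Sum>P | partition_on S P \<and> card P = Suc n. \<Sum>Bs\<in>permutations_of_set P. word_prod (map (coeff f) Bs))"
proof -
  let ?X = "{P. partition_on S P \<and> card P = Suc n}"
  have fin: "finite ?X"
    by (rule finite_subset[of _ "Pow (Pow S)"]) (use assms in \<open>auto simp: partition_on_def\<close>)
  have "ordered_partitions (Suc n) S = (\<Union>P\<in>?X. permutations_of_set P)"
    by (auto simp: ordered_partitions_def permutations_of_set_def distinct_card)
  moreover have "(\<Sum>Bs\<in>(\<Union>P\<in>?X. permutations_of_set P). word_prod (map (coeff f) Bs)) =
      (\<Sum>P\<in>?X. \<Sum>Bs\<in>permutations_of_set P. word_prod (map (coeff f) Bs))"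
  proof (rule sum.UNION_disjoint[OF fin])
    show "\<forall>P\<in>?X. finite (permutations_of_set P)" by simp
  qed (auto simp: permutations_of_set_def)
  ultimately show ?thesis by (simp add: coeff_rpow[OF assms])
qed

text \<open>The symmetric identity of degree \<open>d\<close> says that the series without constant term are nil of
  index \<open>d\<close>: the coefficients of \<open>f\<^sup>d\<close> are sums of values of \<open>s\<^sub>d\<close>.\<close>
lemma symmetric_identity_imp_rpow_eq_0:
  assumes id: "satisfies_symmetric_identity (Suc n) A"
    and f: "coeff f {} = 0" "\<And>S. coeff f S \<in> A"
  shows "rpow f n = 0"
proof (rule sqfree_eqI)
  fix S
  have sym: "symmetric_poly (Suc n) a = 0" if "\<And>j. a j \<in> A" for a
    using id that by (simp add: satisfies_symmetric_identity_def)
  show "coeff (rpow f n) S = coeff 0 S"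
  proof (cases "finite S")
    case True
    have "(\<Sum>Bs\<in>permutations_of_set P. word_prod (map (coeff f) Bs)) = 0" if "card P = Suc n" for P
    proof -
      have "finite P" using that by (metis card.infinite nat.distinct(1))
      then obtain xs where "distinct xs" "P = set xs" by (metis finite_distinct_list)
      with that show ?thesis
        using sum_permutations_of_set[of xs "Suc n" "coeff f"] sym[of "\<lambda>j. coeff f (xs ! (j - 1))"] f(2)
        by (simp add: distinct_card)
    qed
    then show ?thesis
      by (simp add: coeff_rpow_partitions[OF True f(1)])
  next
    \<comment> \<open>At an infinite set a product has coefficient 0 by convention, but the first
      power is \<open>f\<close> itself; there the identity of degree 1 gives the claim.\<close>
    case False
    show ?thesis
    proof (cases n)
      case 0
      with sym[of "\<lambda>_. coeff f S"] f(2) show ?thesis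
        by (simp add: symmetric_poly_def)
    next
      case (Suc m)
      with False show ?thesis by (simp add: coeff_mult)
    qed
  qed
qed

text \<open>The linear form sum_i e_i a_i.\<close>

definition lin :: "(nat \<Rightarrow> 'a::ring) \<Rightarrow> 'a sqfree" where
  "lin a = Sqfree (\<lambda>S. if is_singleton S then a (the_elem S) else 0)"

lemma coeff_lin_singleton [simp]: "coeff (lin a) {i} = a i"
  by (simp add: lin_def)

lemma coeff_lin_eq_0: "\<not> is_singleton S \<Longrightarrow> coeff (lin a) S = 0"
  by (simp add: lin_def)

lemma coeff_lin_empty [simp]: "coeff (lin a) {} = 0"
  by (simp add: coeff_lin_eq_0 is_singleton_def)

lemma coeff_lin_mem: "(\<And>i. a i \<in> A) \<Longrightarrow> 0 \<in> A \<Longrightarrow> coeff (lin a) S \<in> A"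
  by (simp add: lin_def)

lemma word_prod_eq_0: "0 \<in> set xs \<Longrightarrow> word_prod xs = 0"
  by (induction xs rule: word_prod.induct) auto

text \<open>The converse link between powers and the symmetric polynomial. Every partition of
  \<open>{1..Suc n}\<close> other than the one into singletons has a block on which
  \<open>lin a\<close> vanishes, so only the orderings of the singletons remain.\<close>

lemma coeff_rpow_lin: "coeff (rpow (lin a) n) {1..Suc n} = symmetric_poly (Suc n) a"
proof -
  let ?S = "{1..Suc n}" and ?P = "(\<lambda>i. {i}) ` {1..Suc n}"
  have P: "partition_on ?S ?P" "card ?P = Suc n"
    by (auto simp: partition_on_def disjoint_def card_image)
  have z: "(\<Sum>Bs\<in>permutations_of_set P. word_prod (map (coeff (lin a)) Bs)) = 0"
    if part: "partition_on ?S P" and "P \<noteq> ?P" for P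
  proof (rule sum.neutral, rule ballI)
    fix Bs assume Bs: "Bs \<in> permutations_of_set P"
    have "\<exists>B\<in>P. \<not> is_singleton B"
    proof (rule ccontr)
      assume neg: "\<not> (\<exists>B\<in>P. \<not> is_singleton B)"
      have "P \<subseteq> ?P"
      proof
        fix B assume "B \<in> P"
        moreover from this neg obtain i where "B = {i}" by (auto simp: is_singleton_def)
        ultimately show "B \<in> ?P" using part by (auto simp: partition_on_def)
      qed
      moreover have "?P \<subseteq> P"
      proof
        fix B assume "B \<in> ?P"
        then obtain i where i: "i \<in> ?S" "B = {i}" by auto
        then have "i \<in> \<Union> P" using part by (simp add: partition_on_def)
        then obtain C where "C \<in> P" "i \<in> C" by blast
        moreover with neg have "C = {i}" by (auto simp: is_singleton_def)
        ultimately show "B \<in> P" using i by simp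
      qed
      ultimately show False using that(2) by blast
    qed
    then obtain B where "B \<in> P" "coeff (lin a) B = 0" by (auto simp: coeff_lin_eq_0)
    moreover have "set Bs = P" using Bs by (simp add: permutations_of_set_def)
    ultimately have "0 \<in> set (map (coeff (lin a)) Bs)" by force
    then show "word_prod (map (coeff (lin a)) Bs) = 0" by (rule word_prod_eq_0)
  qed
  have fin: "finite {P. partition_on ?S P \<and> card P = Suc n}"
    by (rule finite_subset[of _ "Pow (Pow ?S)"]) (auto simp: partition_on_def)
  have "coeff (rpow (lin a) n) ?S =
      (\<Sum>P | partition_on ?S P \<and> card P = Suc n. \<Sum>Bs\<in>permutations_of_set P. word_prod (map (coeff (lin a)) Bs))"
    by (rule coeff_rpow_partitions) auto
  also have "\<dots> = (\<Sum>P\<in>{?P}. \<Sum>Bs\<in>permutations_of_set P. word_prod (map (coeff (lin a)) Bs))"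
    by (rule sum.mono_neutral_right) (use fin P z in auto)
  also have "\<dots> = (\<Sum>Bs\<in>permutations_of_set (set (map (\<lambda>i. {i}) [1..<Suc (Suc n)])).
      word_prod (map (coeff (lin a)) Bs))"
    by (simp add: atLeastLessThanSuc_atLeastAtMost del: upt_Suc)
  also have "\<dots> = symmetric_poly (Suc n) (\<lambda>j. coeff (lin a) (map (\<lambda>i. {i}) [1..<Suc (Suc n)] ! (j - 1)))"
    by (rule sum_permutations_of_set) (simp_all add: distinct_map inj_on_def del: upt_Suc)
  also have "\<dots> = symmetric_poly (Suc n) a"
    unfolding symmetric_poly_def
  proof (intro sum.cong refl arg_cong[where f=word_prod] map_cong)
    fix \<sigma> j assume "\<sigma> \<in> {\<sigma>. \<sigma> permutes {1..Suc n}}" "j \<in> set [1..<Suc (Suc n)]"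
    then have "\<sigma> j \<in> {1..Suc n}"
      using permutes_in_image[of \<sigma> "{1..Suc n}" j] by auto
    then show "coeff (lin a) (map (\<lambda>i. {i}) [1..<Suc (Suc n)] ! (\<sigma> j - 1)) = a (\<sigma> j)"
      by (subst nth_map) (auto simp del: upt_Suc)
  qed
  finally show ?thesis .
qed

text \<open>By commutativity s_p is p! times a product, and p divides p!. This is how the
  characteristic enters: scalar series without constant term have p-th power 0.\<close>

lemma field_satisfies_symmetric_identity:
  assumes "CHAR('f::field) = p" "p > 0"
  shows "satisfies_symmetric_identity p (UNIV :: 'f set)"
proof -
  \<comment> \<open>On the empty list the two sides differ: the dummy value is 0, the empty product
    1.\<close>
  have wp: "word_prod xs = prod_list xs" if "xs \<noteq> []" for xs :: "'f list"
    using that by (induction xs rule: word_prod.induct) auto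
  have "symmetric_poly p a = 0" for a :: "nat \<Rightarrow> 'f"
  proof -
    have "word_prod (map (\<lambda>j. a (\<sigma> j)) [1..<Suc p]) = prod a {1..p}" if "\<sigma> permutes {1..p}" for \<sigma>
    proof -
      have "word_prod (map (\<lambda>j. a (\<sigma> j)) [1..<Suc p]) = (\<Prod>j\<in>{1..p}. a (\<sigma> j))"
        using assms(2) by (subst wp) (simp_all add: prod.distinct_set_conv_list[symmetric] atLeastLessThanSuc_atLeastAtMost del: upt_Suc)
      also have "\<dots> = prod a {1..p}"
        using prod.permute[OF that, of a] by (simp add: o_def)
      finally show ?thesis .
    qed
    then have "symmetric_poly p a = of_nat (fact p) * prod a {1..p}"
      by (simp add: symmetric_poly_def card_permutations[of _ p])
    moreover have "of_nat (fact p) = (0::'f)"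
      using assms by (simp add: of_nat_eq_0_iff_char_dvd dvd_fact)
    ultimately show ?thesis by simp
  qed
  with assms(2) show ?thesis by (simp add: satisfies_symmetric_identity_def)
qed

subsection \<open>Nilpotence of sums\<close>

text \<open>This is x + x^2 + ... + x^m, hence (1 - x)^-1 - 1 when x^(m+1) = 0.\<close>

definition geo :: "'a::ring \<Rightarrow> nat \<Rightarrow> 'a" where
  "geo x m = (\<Sum>n<m. rpow x n)"

text \<open>The equation (1 - x)(1 + \<open>geo x m\<close>) = 1 written without unity.
  Multiplication by x shifts the sum by one place, and its new top term x^(m+1) is 0.\<close>

lemma geo_eq:
  assumes "rpow x m = 0"
  shows "geo x m = x + x * geo x m"
proof (cases m)
  case 0
  with assms show ?thesis by (simp add: geo_def)
next
  case (Suc l)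
  have "x * geo x m = (\<Sum>n<Suc l. rpow x (Suc n))"
    by (simp add: geo_def Suc sum_distrib_left distrib_left)
  also have "\<dots> = (\<Sum>n<l. rpow x (Suc n))"
    using assms Suc by simp
  finally show ?thesis
    unfolding geo_def Suc by (subst sum.lessThan_Suc_shift) simp
qed

text \<open>With a unity adjoined, \<open>(1 - P)\<inverse> = 1 + \<alpha>\<close> and \<open>(1 - Q)\<inverse> = 1 + \<beta>\<close>, hence
  \<open>(1 + \<alpha>)(1 - P - Q)(1 + \<beta>) = 1 - \<alpha>\<beta>\<close>, so that
  \<open>(1 - P - Q)\<inverse> = (1 + \<beta>)(1 - \<alpha>\<beta>)\<inverse>(1 + \<alpha>)\<close>; here \<open>(1 - \<alpha>\<beta>)\<inverse> = 1 + G\<close>.\<close>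
lemma quasi_inverse_sum:
  fixes P Q :: "'a::ring"
  assumes \<alpha>: "\<alpha> = P + P * \<alpha>" and \<beta>: "\<beta> = Q + Q * \<beta>" and G: "G = \<alpha> * \<beta> + \<alpha> * \<beta> * G"
    and U: "U = G + \<alpha> + G * \<alpha>" and C: "C = \<beta> + U + \<beta> * U"
  shows "C = (P + Q) + (P + Q) * C"
proof -
  \<comment> \<open>With a unity adjoined, 1 + U = (1 + G)(1 + \<alpha>) and 1 + C = (1 + \<beta>)(1
    + U). The fact \<open>U'\<close> below reads U = P (1 + C), and \<beta> (1 + U) = Q (1 +
    \<beta>)(1 + U) = Q (1 + C). Adding the two gives C = (P + Q)(1 + C).\<close>
  have "\<alpha> * \<beta> = P * \<beta> + P * (\<alpha> * \<beta>)"
    by (metis \<alpha> distrib_right mult.assoc)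
  then have "G = P * \<beta> + P * (\<alpha> * \<beta>) + (P * \<beta> + P * (\<alpha> * \<beta>)) * G"
    using G by metis
  also have "\<dots> = P * \<beta> + P * (\<alpha> * \<beta> + \<alpha> * \<beta> * G) + P * \<beta> * G"
    by (simp add: algebra_simps)
  also have "\<alpha> * \<beta> + \<alpha> * \<beta> * G = G"
    by (rule G[symmetric])
  finally have G': "G = P * G + P * \<beta> + P * \<beta> * G"
    by (simp add: algebra_simps)
  then have "G * \<alpha> = P * G * \<alpha> + P * \<beta> * \<alpha> + P * \<beta> * G * \<alpha>"
    by (metis distrib_right)
  with G' \<alpha> have "U =
      (P * G + P * \<beta> + P * \<beta> * G) + (P + P * \<alpha>) + (P * G * \<alpha> + P * \<beta> * \<alpha> + P * \<beta> * G * \<alpha>)"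
    using U by metis
  also have "\<dots> = P + P * \<beta> + P * (G + \<alpha> + G * \<alpha>) + P * \<beta> * (G + \<alpha> + G * \<alpha>)"
    by (simp add: algebra_simps)
  finally have U': "U = P + P * \<beta> + P * U + P * \<beta> * U"
    unfolding U[symmetric] .
  have "\<beta> * U = Q * U + Q * \<beta> * U"
    by (metis \<beta> distrib_right)
  moreover have "(P + Q) + (P + Q) * C =
      (Q + Q * \<beta>) + (P + P * \<beta> + P * U + P * \<beta> * U) + (Q * U + Q * \<beta> * U)"
    unfolding C by (simp add: algebra_simps)
  ultimately show ?thesis
    using C U' \<beta> by metis
qed

text \<open>Iterating the equation for \<open>C\<close> expands it as a geometric series with
  remainder y^(n+1) C, from which a single power of y can be read off by degree.\<close>

lemma quasi_inverse_expand:
  fixes y :: "'a::ring"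
  assumes "C = y + y * C"
  shows "C = geo y (Suc n) + rpow y n * C"
proof (induction n)
  case 0
  have "geo y (Suc 0) = y" by (simp add: geo_def)
  then show ?case using assms by (metis rpow.simps(1))
next
  case (Suc n)
  have "rpow y n * C = rpow y n * (y + y * C)"
    using assms by (rule arg_cong)
  also have "\<dots> = rpow y n * rpow y 0 + rpow y n * rpow y 0 * C"
    by (simp add: algebra_simps)
  also have "\<dots> = rpow y (Suc n) + rpow y (Suc n) * C"
    by (simp only: rpow_mult add_0_right)
  finally have "geo y (Suc n) + rpow y n * C =
      geo y (Suc n) + (rpow y (Suc n) + rpow y (Suc n) * C)"
    by (rule arg_cong)
  with Suc have "C = geo y (Suc n) + (rpow y (Suc n) + rpow y (Suc n) * C)"
    by (rule trans)
  moreover have "geo y (Suc (Suc n)) = geo y (Suc n) + rpow y (Suc n)"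
    by (simp add: geo_def)
  ultimately show ?case
    by (metis add.assoc)
qed

section \<open>Degree and homogeneity of square-free series\<close>

definition deg_le :: "nat \<Rightarrow> 'a::ring sqfree \<Rightarrow> bool" where
  "deg_le n f \<longleftrightarrow> (\<forall>S. finite S \<longrightarrow> n < card S \<longrightarrow> coeff f S = 0)"

definition homogeneous :: "nat \<Rightarrow> 'a::ring sqfree \<Rightarrow> bool" where
  "homogeneous n f \<longleftrightarrow> (\<forall>S. coeff f S \<noteq> 0 \<longrightarrow> finite S \<and> card S = n)"

lemma deg_le_add: "deg_le n f \<Longrightarrow> deg_le n g \<Longrightarrow> deg_le n (f + g)"
  by (simp add: deg_le_def)

lemma deg_le_mono: "deg_le m f \<Longrightarrow> m \<le> n \<Longrightarrow> deg_le n f"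
  by (force simp: deg_le_def)

lemma deg_le_sum: "(\<And>x. x \<in> A \<Longrightarrow> deg_le n (F x)) \<Longrightarrow> deg_le n (sum F A)"
  by (simp add: deg_le_def coeff_sum)

lemma deg_le_mult:
  assumes "deg_le m f" "deg_le n g"
  shows "deg_le (m + n) (f * g)"
  unfolding deg_le_def
proof (intro allI impI)
  fix S :: "nat set" assume S: "finite S" "m + n < card S"
  have "coeff f T * coeff g (S - T) = 0" if "T \<in> Pow S" for T
  proof -
    have T: "finite T" "card T + card (S - T) = card S"
      using that S by (auto simp: finite_subset card_Diff_subset card_mono)
    with S(2) have "m < card T \<or> n < card (S - T)" by linarith
    moreover have "finite (S - T)" using S(1) by simp
    ultimately have "coeff f T = 0 \<or> coeff g (S - T) = 0"
      using T(1) assms unfolding deg_le_def by blast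
    then show ?thesis by auto
  qed
  then show "coeff (f * g) S = 0"
    unfolding coeff_mult by (intro sum.neutral ballI)
qed

lemma deg_le_rpow: "deg_le d f \<Longrightarrow> deg_le (Suc n * d) (rpow f n)"
  by (induction n) (auto dest: deg_le_mult)

lemma homogeneous_add: "homogeneous n f \<Longrightarrow> homogeneous n g \<Longrightarrow> homogeneous n (f + g)"
  by (force simp: homogeneous_def)

lemma homogeneous_mult:
  assumes "homogeneous m f" "homogeneous n g"
  shows "homogeneous (m + n) (f * g)"
  unfolding homogeneous_def
proof (intro allI impI)
  fix S :: "nat set" assume "coeff (f * g) S \<noteq> 0"
  then obtain T where T: "T \<in> Pow S" "coeff f T * coeff g (S - T) \<noteq> 0"
    unfolding coeff_mult by (meson sum.not_neutral_contains_not_neutral)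
  then have "coeff f T \<noteq> 0" "coeff g (S - T) \<noteq> 0" by auto
  with assms have *: "finite T" "card T = m" "finite (S - T)" "card (S - T) = n"
    by (auto simp: homogeneous_def)
  moreover have "S = T \<union> (S - T)" using T(1) by auto
  ultimately show "finite S \<and> card S = m + n"
    by (metis Diff_disjoint card_Un_disjoint finite_Un)
qed

lemma homogeneous_rpow: "homogeneous 1 f \<Longrightarrow> homogeneous (Suc n) (rpow f n)"
  by (induction n) (auto dest: homogeneous_mult[of "Suc 0"])

lemma homogeneous_imp_deg_le: "homogeneous n f \<Longrightarrow> deg_le n f"
  by (force simp: homogeneous_def deg_le_def)

lemma homogeneous_lin: "homogeneous 1 (lin a)"
  by (auto simp: homogeneous_def lin_def is_singleton_def split: if_splits)

lemma deg_le_geo: "deg_le d f \<Longrightarrow> deg_le (m * d) (geo f m)"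
  unfolding geo_def
proof (rule deg_le_sum)
  fix n assume f: "deg_le d f" and "n \<in> {..<m}"
  then have "Suc n * d \<le> m * d" by (intro mult_le_mono1) simp
  with deg_le_rpow[OF f] show "deg_le (m * d) (rpow f n)" by (rule deg_le_mono)
qed

text \<open>The series \<open>C\<close> is (1 - P - Q)^-1 - 1, and its construction bounds its
  degree by n + K (m + n) + m, which is at most \<open>N\<close>. Since P + Q is homogeneous of
  degree 1, its power \<open>N + 1\<close> is the component of \<open>C\<close> in degree
  \<open>N + 1\<close> and vanishes.\<close>

lemma rpow_add_eq_0:
  assumes P: "homogeneous 1 P" "rpow P m = 0" and Q: "homogeneous 1 Q" "rpow Q n = 0"
    and nil: "rpow (geo P m * geo Q n) K = 0" and N: "Suc K * (m + n) \<le> N"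
  shows "rpow (P + Q) N = 0"
proof -
  define \<alpha> \<beta> where "\<alpha> = geo P m" and "\<beta> = geo Q n"
  define G where "G = geo (\<alpha> * \<beta>) K"
  define U where "U = G + \<alpha> + G * \<alpha>"
  define C where "C = \<beta> + U + \<beta> * U"
  have C_eq: "C = (P + Q) + (P + Q) * C"
    by (rule quasi_inverse_sum[OF _ _ _ U_def C_def])
       (unfold \<alpha>_def \<beta>_def G_def, (rule geo_eq P Q nil)+)
  have da: "deg_le m \<alpha>" and db: "deg_le n \<beta>"
    using deg_le_geo[of 1 P m] deg_le_geo[of 1 Q n] P(1) Q(1)
    by (simp_all add: homogeneous_imp_deg_le \<alpha>_def \<beta>_def)
  have dG: "deg_le (K * (m + n)) G"
    unfolding G_def by (rule deg_le_geo, rule deg_le_mult[OF da db])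
  have dU: "deg_le (K * (m + n) + m) U"
    unfolding U_def
    by (intro deg_le_add deg_le_mult da dG) (rule deg_le_mono[OF dG], simp, rule deg_le_mono[OF da], simp)
  have "deg_le (n + (K * (m + n) + m)) C"
    unfolding C_def
    by (intro deg_le_add deg_le_mult db dU) (rule deg_le_mono[OF db], simp, rule deg_le_mono[OF dU], simp)
  then have dC: "deg_le N C"
    by (rule deg_le_mono) (use N in \<open>simp add: algebra_simps\<close>)
  have y: "homogeneous 1 (P + Q)"
    using P(1) Q(1) by (rule homogeneous_add)
  have C0: "coeff C {} = 0"
  proof -
    have "coeff C {} = coeff (P + Q) {} + coeff (P + Q) {} * coeff C {}"
      by (rule trans[OF arg_cong[OF C_eq, of "\<lambda>f. coeff f {}"]]) (simp add: coeff_mult)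
    moreover have "coeff (P + Q) {} = 0"
      using y by (force simp: homogeneous_def)
    ultimately show ?thesis by simp
  qed
  show ?thesis
  proof (rule sqfree_eqI)
    fix S
    show "coeff (rpow (P + Q) N) S = coeff 0 S"
    proof (cases "finite S \<and> card S = Suc N")
      case False
      then show ?thesis using homogeneous_rpow[OF y, of N] by (auto simp: homogeneous_def)
    next
      case True
      \<comment> \<open>The power of P + Q already uses up all N + 1 elements of \<open>S\<close>,
        which leaves only the constant term of \<open>C\<close>, and that is 0.\<close>
      have "coeff (rpow (P + Q) N) T * coeff C (S - T) = 0" if "T \<in> Pow S" for T
      proof (cases "coeff (rpow (P + Q) N) T = 0")
        case False
        then have "card T = card S"
          using homogeneous_rpow[OF y, of N] True by (auto simp: homogeneous_def)
        with that True have "T = S" by (simp add: card_subset_eq)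
        then show ?thesis using C0 by simp
      qed simp
      then have "coeff (rpow (P + Q) N * C) S = 0" by (simp add: coeff_mult)
      moreover have "coeff (rpow (P + Q) i) S = 0" if "i < N" for i
        using homogeneous_rpow[OF y, of i] True that by (auto simp: homogeneous_def)
      then have "coeff (geo (P + Q) (Suc N)) S = coeff (rpow (P + Q) N) S"
        by (simp add: geo_def coeff_sum)
      moreover have "coeff C S = 0" using dC True by (simp add: deg_le_def)
      moreover have "coeff C S =
          coeff (geo (P + Q) (Suc N)) S + coeff (rpow (P + Q) N * C) S"
        by (rule trans[OF arg_cong[OF quasi_inverse_expand[OF C_eq, of N], of "\<lambda>f. coeff f S"]]) simp
      ultimately show ?thesis by simp
    qed
  qed
qed

subsection \<open>Coefficients in subspaces\<close>

definition valued :: "'a::ring set \<Rightarrow> 'a sqfree \<Rightarrow> bool" where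
  "valued A f \<longleftrightarrow> coeff f {} = 0 \<and> (\<forall>S. coeff f S \<in> A)"

lemma valued_sum:
  assumes "0 \<in> A" "\<And>x y. x \<in> A \<Longrightarrow> y \<in> A \<Longrightarrow> x + y \<in> A" "\<And>i. i \<in> I \<Longrightarrow> valued A (F i)"
  shows "valued A (sum F I)"
  using assms(3) by (induction I rule: infinite_finite_induct) (auto simp: valued_def assms(1,2))

lemma sum_mem:
  assumes "0 \<in> A" "\<And>x y. x \<in> A \<Longrightarrow> y \<in> A \<Longrightarrow> x + y \<in> A" "\<And>i. i \<in> I \<Longrightarrow> F i \<in> A"
  shows "sum F I \<in> A"
  using assms(3) by (induction I rule: infinite_finite_induct) (auto simp: assms(1,2))

lemma valued_geo:
  assumes "0 \<in> A" "\<And>x y. x \<in> A \<Longrightarrow> y \<in> A \<Longrightarrow> x + y \<in> A" "\<And>x y. x \<in> A \<Longrightarrow> y \<in> A \<Longrightarrow> x * y \<in> A"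
    and f: "valued A f"
  shows "valued A (geo f m)"
proof -
  have "valued A (rpow f n)" for n
  proof (induction n)
    case (Suc n)
    have "coeff (f * rpow f n) S \<in> A" for S
      unfolding coeff_mult
      by (rule sum_mem) (use assms Suc in \<open>auto simp: valued_def\<close>)
    moreover have "coeff (f * rpow f n) {} = 0"
      using f by (simp add: coeff_mult valued_def)
    ultimately show ?case by (simp add: valued_def)
  qed (simp add: f)
  then show ?thesis
    unfolding geo_def by (intro valued_sum assms) auto
qed

text \<open>Prefixing one pair follows the recursion of \<open>rpow\<close>.\<close>

lemma alternating_products_Suc:
  assumes "a \<in> A" "b \<in> B" "v \<in> alternating_products A B (Suc k)"
  shows "a * (b * v) \<in> alternating_products A B (Suc (Suc k))"
proof -
  obtain x y where xy: "\<forall>j\<in>{1..Suc k}. x j \<in> A" "\<forall>j\<in>{1..Suc k}. y j \<in> B"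
    and v: "v = word_prod (concat (map (\<lambda>j. [x j, y j]) [1..<Suc (Suc k)]))"
    using assms(3) unfolding alternating_products_def by blast
  \<comment> \<open>The families start at index 1, so the given ones move up by one place to make
    room for \<open>a\<close> and \<open>b\<close>.\<close>
  define x' y' where "x' = (\<lambda>j. if j = 1 then a else x (j - 1))"
    and "y' = (\<lambda>j. if j = 1 then b else y (j - 1))"
  have xs: "concat (map (\<lambda>j. [x' j, y' j]) [1..<Suc (Suc (Suc k))]) =
      a # b # concat (map (\<lambda>j. [x j, y j]) [1..<Suc (Suc k)])" (is "_ = a # b # ?ws")
  proof -
    have "[1..<Suc (Suc (Suc k))] = 1 # map Suc [1..<Suc (Suc k)]"
      by (simp add: map_Suc_upt upt_conv_Cons del: upt_Suc)
    moreover have "map (\<lambda>j. [x' j, y' j]) (map Suc [1..<Suc (Suc k)]) = map (\<lambda>j. [x j, y j]) [1..<Suc (Suc k)]"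
      by (auto simp: x'_def y'_def simp del: upt_Suc)
    ultimately show ?thesis by (simp add: x'_def y'_def del: upt_Suc map_map)
  qed
  \<comment> \<open>Only in front of a nonempty list does \<open>word_prod\<close> continue with a
    product after \<open>b\<close>.\<close>
  moreover obtain w ws where "?ws = w # ws"
    by (simp add: upt_conv_Cons del: upt_Suc)
  ultimately have "word_prod (concat (map (\<lambda>j. [x' j, y' j]) [1..<Suc (Suc (Suc k))])) = a * (b * v)"
    by (simp add: v del: upt_Suc)
  moreover have "\<forall>j\<in>{1..Suc (Suc k)}. x' j \<in> A" "\<forall>j\<in>{1..Suc (Suc k)}. y' j \<in> B"
    using xy assms unfolding x'_def y'_def by fastforce+
  ultimately show ?thesis
    unfolding alternating_products_def
    by (intro CollectI exI[of _ x'] exI[of _ y'] conjI) (simp_all only:)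
qed

lemma alternating_products_1: "a \<in> A \<Longrightarrow> b \<in> B \<Longrightarrow> a * b \<in> alternating_products A B (Suc 0)"
  unfolding alternating_products_def
  by (rule CollectI, rule exI[of _ "\<lambda>_. a"], rule exI[of _ "\<lambda>_. b"]) simp

text \<open>\<open>N\<close> is merely closed under addition, not under multiplication by
  \<open>A\<close> or \<open>B\<close>. The induction therefore varies \<open>N\<close>: its
  hypothesis is applied to the set of all v with a (b v) in \<open>N\<close>, where a and b are the
  coefficients split off on the left.\<close>

lemma coeff_rpow_alternating:
  assumes f: "valued A f" and g: "valued B g"
    and "0 \<in> N" "\<And>x y. x \<in> N \<Longrightarrow> y \<in> N \<Longrightarrow> x + y \<in> N"
    and "alternating_products A B (Suc k) \<subseteq> N"
  shows "coeff (rpow (f * g) k) S \<in> N"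
  using assms(3-)
proof (induction k arbitrary: N S)
  case 0
  have "coeff f T * coeff g U \<in> N" for T U
    using alternating_products_1[of "coeff f T" A "coeff g U" B] f g 0(3) by (auto simp: valued_def)
  then show ?case
    unfolding rpow.simps coeff_mult by (intro sum_mem 0)
next
  case (Suc k)
  have "coeff f T * (coeff g U * coeff (rpow (f * g) k) V) \<in> N" for T U V
  proof -
    let ?N = "{v. coeff f T * (coeff g U * v) \<in> N}"
    have "coeff (rpow (f * g) k) V \<in> ?N"
    proof (rule Suc.IH)
      have "coeff f T \<in> A" "coeff g U \<in> B"
        using f g by (simp_all add: valued_def)
      then show "alternating_products A B (Suc k) \<subseteq> ?N"
        using Suc.prems(3) alternating_products_Suc[of "coeff f T" A "coeff g U" B _ k] by blast
    qed (use Suc.prems in \<open>auto simp: distrib_left\<close>)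
    then show ?thesis by simp
  qed
  then have "coeff (f * (g * rpow (f * g) k)) S \<in> N"
    unfolding coeff_mult[of f] coeff_mult[of g] sum_distrib_left by (intro sum_mem Suc.prems) auto
  then show ?case by (simp only: rpow.simps mult.assoc)
qed

subsection \<open>The filtration by powers of nilpotent scalars\<close>

text \<open>As \<open>'r\<close> need not have a unity, scalar series are not series over
  \<open>'r\<close>; they act on them instead.\<close>

definition act :: "('f::field \<Rightarrow> 'r::ring \<Rightarrow> 'r) \<Rightarrow> 'f sqfree \<Rightarrow> 'r sqfree \<Rightarrow> 'r sqfree" where
  "act scale w h = Sqfree (subset_conv scale (coeff w) (coeff h))"

context assoc_algebra
begin

lemma act_mult: "act scale (v * w) h = act scale v (act scale w h)"
  unfolding act_def times_sqfree_def sqfree.sel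
  by (rule arg_cong[where f = Sqfree], rule subset_conv_assoc)
     (simp_all add: scale_left_distrib scale_right_distrib)

lemma act_mult_left: "act scale w f * g = act scale w (f * g)"
  unfolding act_def times_sqfree_def sqfree.sel
  by (rule arg_cong[where f = Sqfree], rule subset_conv_assoc)
     (simp_all add: distrib_right scale_right_distrib mult_scale_left)

text \<open>The scalar series has to pass \<open>f\<close>. Written to the right of
  \<open>g\<close>, it turns the claim into an instance of associativity.\<close>

lemma act_mult_right: "f * act scale w g = act scale w (f * g)"
proof -
  have "subset_conv (*) (coeff f) (subset_conv scale (coeff w) (coeff g)) =
      subset_conv (*) (coeff f) (subset_conv (\<lambda>a c. scale c a) (coeff g) (coeff w))"
    by (simp only: subset_conv_commute[of scale])
  also have "\<dots> = subset_conv (\<lambda>a c. scale c a) (subset_conv (*) (coeff f) (coeff g)) (coeff w)"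
    by (rule subset_conv_assoc[symmetric])
       (simp_all add: distrib_left scale_right_distrib mult_scale_right)
  also have "\<dots> = subset_conv scale (coeff w) (subset_conv (*) (coeff f) (coeff g))"
    by (simp only: subset_conv_commute[of scale])
  finally show ?thesis by (simp add: act_def times_sqfree_def)
qed

lemma act_commute: "act scale v (act scale w h) = act scale w (act scale v h)"
proof -
  have "v * w = w * v"
    unfolding times_sqfree_def by (subst subset_conv_commute) (simp add: mult.commute)
  then show ?thesis by (metis act_mult)
qed

lemma act_add: "act scale w (f + g) = act scale w f + act scale w g"
  by (rule sqfree_eqI) (simp add: act_def subset_conv_def scale_right_distrib sum.distrib)

lemma act_0_right [simp]: "act scale w 0 = 0"
  by (rule sqfree_eqI) (simp add: act_def subset_conv_def)

lemma act_0_left [simp]: "act scale 0 h = 0"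
  by (rule sqfree_eqI) (simp add: act_def subset_conv_def)

lemma act_sum: "act scale w (sum F A) = (\<Sum>x\<in>A. act scale w (F x))"
  by (induction A rule: infinite_finite_induct) (auto simp: act_add)

lemma funpow_act: "(act scale w ^^ Suc n) h = act scale (rpow w n) h"
  by (induction n) (simp_all add: act_mult)

text \<open>Rewrites sum_i e_i c_i b as a scalar linear form acting on the constant series b, which
  is the shape of a summand in the filtration.\<close>

lemma act_lin_const:
  "coeff (act scale (lin c) (Sqfree (\<lambda>S. if S = {} then b else 0))) S = coeff (lin (\<lambda>i. scale (c i) b)) S"
proof (cases "finite S")
  case True
  have "coeff (act scale (lin c) (Sqfree (\<lambda>S. if S = {} then b else 0))) S =
      (\<Sum>T\<in>Pow S. scale (coeff (lin c) T) (if S - T = {} then b else 0))"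
    by (simp add: act_def subset_conv_def)
  also have "\<dots> = (\<Sum>T\<in>{S}. scale (coeff (lin c) T) (if S - T = {} then b else 0))"
    by (rule sum.mono_neutral_right) (use True in auto)
  also have "\<dots> = coeff (lin (\<lambda>i. scale (c i) b)) S"
    by (simp add: lin_def)
  finally show ?thesis .
next
  case False
  then show ?thesis
    by (auto simp: act_def subset_conv_infinite lin_def is_singleton_def)
qed

text \<open>For finite \<open>J\<close> this is I^n H, where H consists of all series over
  \<open>'r\<close> and I is the ideal of scalar series generated by the \<open>W j\<close> with j
  in \<open>J\<close>.\<close>

primrec filtration :: "('j \<Rightarrow> 'f sqfree) \<Rightarrow> 'j set \<Rightarrow> nat \<Rightarrow> 'r sqfree set" where
  "filtration W J 0 = UNIV"
| "filtration W J (Suc n) = {\<Sum>j\<in>J. act scale (W j) (h j) | h. \<forall>j\<in>J. h j \<in> filtration W J n}"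

lemma filtration_SucI:
  "(\<And>j. j \<in> J \<Longrightarrow> h j \<in> filtration W J n) \<Longrightarrow> (\<Sum>j\<in>J. act scale (W j) (h j)) \<in> filtration W J (Suc n)"
  by auto

lemma filtration_SucE:
  assumes "f \<in> filtration W J (Suc n)"
  obtains h where "f = (\<Sum>j\<in>J. act scale (W j) (h j))" "\<And>j. j \<in> J \<Longrightarrow> h j \<in> filtration W J n"
  using assms by auto

lemma filtration_add: "f \<in> filtration W J n \<Longrightarrow> g \<in> filtration W J n \<Longrightarrow> f + g \<in> filtration W J n"
proof (induction n arbitrary: f g)
  case (Suc n)
  obtain h where h: "f = (\<Sum>j\<in>J. act scale (W j) (h j))" "\<And>j. j \<in> J \<Longrightarrow> h j \<in> filtration W J n"
    using Suc.prems(1) by (rule filtration_SucE) blast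
  obtain k where k: "g = (\<Sum>j\<in>J. act scale (W j) (k j))" "\<And>j. j \<in> J \<Longrightarrow> k j \<in> filtration W J n"
    using Suc.prems(2) by (rule filtration_SucE) blast
  have "f + g = (\<Sum>j\<in>J. act scale (W j) (h j + k j))"
    by (simp add: h(1) k(1) act_add sum.distrib)
  also have "\<dots> \<in> filtration W J (Suc n)"
    by (intro filtration_SucI Suc.IH h k)
  finally show ?case .
qed simp

lemma filtration_mult_left: "g \<in> filtration W J n \<Longrightarrow> f * g \<in> filtration W J n"
proof (induction n arbitrary: g)
  case (Suc n)
  obtain h where h: "g = (\<Sum>j\<in>J. act scale (W j) (h j))" "\<And>j. j \<in> J \<Longrightarrow> h j \<in> filtration W J n"
    using Suc.prems by (rule filtration_SucE) blast
  have "f * g = (\<Sum>j\<in>J. act scale (W j) (f * h j))"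
    by (simp add: h(1) sum_distrib_left act_mult_right)
  also have "\<dots> \<in> filtration W J (Suc n)"
    by (intro filtration_SucI Suc.IH h)
  finally show ?case .
qed simp

text \<open>Scalars pass through products, so the levels multiply as powers of an ideal; with one
  index 0 this shows that each level absorbs products from both sides.\<close>

lemma filtration_mult:
  "f \<in> filtration W J m \<Longrightarrow> g \<in> filtration W J n \<Longrightarrow> f * g \<in> filtration W J (m + n)"
proof (induction m arbitrary: f)
  case 0
  then show ?case by (simp add: filtration_mult_left)
next
  case (Suc m)
  obtain h where h: "f = (\<Sum>j\<in>J. act scale (W j) (h j))" "\<And>j. j \<in> J \<Longrightarrow> h j \<in> filtration W J m"
    using Suc.prems(1) by (rule filtration_SucE) blast
  have "f * g = (\<Sum>j\<in>J. act scale (W j) (h j * g))"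
    by (simp add: h(1) sum_distrib_right act_mult_left)
  also have "\<dots> \<in> filtration W J (Suc (m + n))"
    by (intro filtration_SucI Suc.IH h Suc.prems)
  finally show ?case by simp
qed

lemma filtration_rpow: "f \<in> filtration W J 1 \<Longrightarrow> rpow f n \<in> filtration W J (Suc n)"
proof (induction n)
  case (Suc n)
  then show ?case using filtration_mult[of f W J 1 "rpow f n" "Suc n"] by (simp del: filtration.simps)
qed simp

lemma foldr_act_0: "foldr (\<lambda>j. act scale (W j)) w 0 = 0"
  by (induction w) simp_all

lemma foldr_act_commute:
  "act scale v (foldr (\<lambda>j. act scale (W j)) w h) = foldr (\<lambda>j. act scale (W j)) w (act scale v h)"
proof (induction w)
  case (Cons i w)
  then show ?case using act_commute[of v "W i"] by simp
qed simp

text \<open>The operators commute, so all occurrences of the letter j can be gathered next to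
  \<open>h\<close>, where they act as a power of \<open>W j\<close>.\<close>

lemma foldr_act_count:
  "foldr (\<lambda>j. act scale (W j)) w h =
    foldr (\<lambda>j. act scale (W j)) (filter (\<lambda>i. i \<noteq> j) w) ((act scale (W j) ^^ count_list w j) h)"
  by (induction w) (auto simp: foldr_act_commute)

text \<open>Pigeonhole principle: in so long a word some letter j occurs more than \<open>n\<close>
  times, and the power \<open>n + 1\<close> of \<open>W j\<close> is 0.\<close>

lemma foldr_act_eq_0:
  assumes J: "finite J" "set w \<subseteq> J" and len: "card J * n < length w"
    and W: "\<And>j. j \<in> J \<Longrightarrow> rpow (W j) n = 0"
  shows "foldr (\<lambda>j. act scale (W j)) w h = 0"
proof -
  have "\<exists>j\<in>J. n < count_list w j"
  proof (rule ccontr)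
    assume "\<not> ?thesis"
    then have "sum (count_list w) J \<le> card J * n"
      using sum_bounded_above[of J "count_list w" n] by (simp add: not_less)
    with len sum_count_set[OF J(2,1)] show False by simp
  qed
  then obtain j where j: "j \<in> J" "n < count_list w j" by blast
  then obtain m where "count_list w j = Suc m" "n \<le> m"
    by (cases "count_list w j") auto
  moreover from this have "rpow (W j) m = 0"
    using W[OF j(1)] rpow_eq_0_mono by blast
  ultimately have "(act scale (W j) ^^ count_list w j) h = 0"
    by (simp only: funpow_act act_0_left)
  then show ?thesis
    by (subst foldr_act_count[of _ _ _ j]) (simp add: foldr_act_0)
qed

text \<open>Unfolding the levels writes \<open>f\<close> as a sum of words of length
  \<open>N\<close> in the \<open>W j\<close> acting on series. In the induction over the remaining
  level m, the word w collects the scalars already split off.\<close>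

lemma filtration_eq_0:
  assumes J: "finite J" and n: "card J * n < N" and W: "\<And>j. j \<in> J \<Longrightarrow> rpow (W j) n = 0"
    and f: "f \<in> filtration W J N"
  shows "f = 0"
proof -
  have "foldr (\<lambda>j. act scale (W j)) w h = 0"
    if "set w \<subseteq> J" "N \<le> length w + m" "h \<in> filtration W J m" for w m h
    using that
  proof (induction m arbitrary: w h)
    case 0
    then show ?case
      using n by (intro foldr_act_eq_0[OF J _ _ W]) auto
  next
    case (Suc m)
    obtain k where k: "h = (\<Sum>j\<in>J. act scale (W j) (k j))" "\<And>j. j \<in> J \<Longrightarrow> k j \<in> filtration W J m"
      using Suc.prems(3) by (rule filtration_SucE) blast
    have *: "foldr (\<lambda>j. act scale (W j)) w (\<Sum>x\<in>J. F x) = (\<Sum>x\<in>J. foldr (\<lambda>j. act scale (W j)) w (F x))" for F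
      by (induction w) (simp_all add: act_sum)
    have "foldr (\<lambda>j. act scale (W j)) w (act scale (W j) (k j)) = 0" if "j \<in> J" for j
      using Suc.IH[of "w @ [j]" "k j"] Suc.prems that k(2) by simp
    then show ?case by (simp add: k(1) *)
  qed
  from this[of "[]" N f] f show ?thesis by simp
qed

text \<open>Elements congruent modulo a two-sided ideal have congruent powers.\<close>

lemma rpow_add_filtration:
  assumes "z \<in> filtration W J n"
  shows "rpow (y + z) m - rpow y m \<in> filtration W J n"
proof (induction m)
  case 0
  then show ?case using assms by simp
next
  case (Suc m)
  have right: "f * g \<in> filtration W J n" if "f \<in> filtration W J n" for f g
    using filtration_mult[OF that, of g 0] by simp
  have "rpow (y + z) (Suc m) - rpow y (Suc m) = (y + z) * (rpow (y + z) m - rpow y m) + z * rpow y m"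
    by (simp add: algebra_simps)
  then show ?case
    using Suc assms by (simp only: filtration_add filtration_mult_left right)
qed

end

section \<open>From nilpotence back to the identity, and the degree D\<close>

lemma valued_lin: "(\<And>i. a i \<in> A) \<Longrightarrow> 0 \<in> A \<Longrightarrow> valued A (lin a)"
  by (simp add: valued_def coeff_lin_mem)

lemma satisfies_symmetric_identity_rpow:
  "satisfies_symmetric_identity d A \<Longrightarrow> d \<ge> 1 \<Longrightarrow> valued A f \<Longrightarrow> rpow f (d - 1) = 0"
  using symmetric_identity_imp_rpow_eq_0[of "d - 1" A f] by (auto simp: valued_def)

text \<open>Nilpotence of linear forms suffices, since the value of the symmetric polynomial is one
  coefficient of their power.\<close>

lemma satisfies_symmetric_identityI:
  assumes "\<And>a. (\<And>j. a j \<in> A) \<Longrightarrow> rpow (lin a) n = 0"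
  shows "satisfies_symmetric_identity (Suc n) A"
  unfolding satisfies_symmetric_identity_def
proof (simp del: upt_Suc, intro allI impI)
  fix a assume a: "\<forall>j\<in>{Suc 0..Suc n}. a j \<in> A"
  \<comment> \<open>Only the first \<open>Suc n\<close> members of \<open>a\<close> are known to lie
    in \<open>A\<close>; the others are replaced by \<open>a 1\<close>.\<close>
  define b where "b = (\<lambda>j. if j \<in> {1..Suc n} then a j else a 1)"
  have "rpow (lin b) n = 0"
    by (rule assms) (use a in \<open>auto simp: b_def\<close>)
  then have "symmetric_poly (Suc n) b = 0"
    by (metis coeff_rpow_lin coeff_simps(1))
  moreover have "symmetric_poly (Suc n) a = symmetric_poly (Suc n) b"
    unfolding symmetric_poly_def
  proof (intro sum.cong refl arg_cong[where f=word_prod] map_cong)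
    fix \<sigma> j assume "\<sigma> \<in> {\<sigma>. \<sigma> permutes {1..Suc n}}" "j \<in> set [1..<Suc (Suc n)]"
    then have "\<sigma> j \<in> {1..Suc n}"
      using permutes_in_image[of \<sigma> "{1..Suc n}" j] by auto
    then show "a (\<sigma> j) = b (\<sigma> j)" by (simp add: b_def)
  qed
  ultimately show "symmetric_poly (Suc n) a = 0" by simp
qed

theorem theorem2p1:
  fixes scale :: "'f::field \<Rightarrow> 'r::ring \<Rightarrow> 'r"
    and R1 R2 L1 L2 :: "'r set"
    and p d1 d2 t1 t2 k :: nat
    and Ri :: "'r set" and di :: nat
  assumes "CHAR('f) = p" and "p > 0"
    and "assoc_algebra scale"
    and "subalgebra scale R1" and "subalgebra scale R2"
    and "\<forall>r. \<exists>r1\<in>R1. \<exists>r2\<in>R2. r = r1 + r2"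
    and "PI_algebra scale R1" and "PI_algebra scale R2"
    and "d1 \<ge> 1" and "d2 \<ge> 1"
    and "satisfies_symmetric_identity d1 R1" and "satisfies_symmetric_identity d2 R2"
    and "k > 0"
    and "subalgebra scale L1" and "L1 \<subseteq> R1"
    and "subalgebra scale L2" and "L2 \<subseteq> R2"
    and "has_codimension scale R1 L1 t1" and "has_codimension scale R2 L2 t2"
    and "(Ri, di) \<in> {(R1, d1), (R2, d2)}"
    and "alternating_products L1 L2 k \<subseteq> Ri"
  shows "satisfies_symmetric_identity
    ((d1 + d2 - 2) * (k * di + 2) * ((t1 + t2) * (p - 1) + 1)) (UNIV :: 'r set)"
proof -
  interpret assoc_algebra scale by fact
  have sub: "0 \<in> A" "\<And>x y. x \<in> A \<Longrightarrow> y \<in> A \<Longrightarrow> x + y \<in> A" "\<And>x y. x \<in> A \<Longrightarrow> y \<in> A \<Longrightarrow> x * y \<in> A"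
    if "subalgebra scale A" for A
    using that by (auto simp: subalgebra_def subspace_def)
  note L1 = sub[OF \<open>subalgebra scale L1\<close>] and L2 = sub[OF \<open>subalgebra scale L2\<close>]
  define e where "e = d1 + d2 - 2"
  show ?thesis
  proof (cases "e = 0")
    \<comment> \<open>Here D = 0, and the identity of degree 0 says that the algebra is zero. Indeed
      d1 = d2 = 1, and the identity of degree 1 is x = 0.\<close>
    case True
    then have d: "d1 = 1" "d2 = 1" using assms(9,10) by (auto simp: e_def)
    have "x = 0" if "satisfies_symmetric_identity 1 A" "x \<in> A" for x :: 'r and A
      using that by (auto simp: satisfies_symmetric_identity_def symmetric_poly_def dest: spec[of _ "\<lambda>_. x"])
    with assms(11,12) d have "x = 0" if "x \<in> R1 \<or> x \<in> R2" for x using that by metis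
    with assms(6) have "x = 0" for x :: 'r by (metis add.left_neutral)
    then show ?thesis using True by (auto simp: satisfies_symmetric_identity_def e_def)
  next
    case False
    have di: "di \<ge> 1" "subalgebra scale Ri" "satisfies_symmetric_identity di Ri"
      using assms(4,5,9-12,20) by auto
    obtain B1 where B1: "finite B1" "card B1 = t1" "\<forall>x\<in>R1. \<exists>c. x - (\<Sum>b\<in>B1. scale (c b) b) \<in> L1"
      using assms(18) by (auto simp: has_codimension_def quotient_basis_def)
    obtain B2 where B2: "finite B2" "card B2 = t2" "\<forall>x\<in>R2. \<exists>c. x - (\<Sum>b\<in>B2. scale (c b) b) \<in> L2"
      using assms(19) by (auto simp: has_codimension_def quotient_basis_def)
    \<comment> \<open>A disjoint sum, since \<open>B1\<close> and \<open>B2\<close> may share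
      elements while \<open>J\<close> has to have t1 + t2 indices.\<close>
    define J where "J = B1 <+> B2"
    define base where "base = (\<lambda>j. case j of Inl b \<Rightarrow> b | Inr b \<Rightarrow> (b::'r))"
    have J: "finite J" "card J = t1 + t2"
      using B1 B2 by (simp_all add: J_def card_Plus)
    have decomp: "\<exists>l1 l2 c. l1 \<in> L1 \<and> l2 \<in> L2 \<and> r = l1 + l2 + (\<Sum>j\<in>J. scale (c j) (base j))" for r
    proof -
      obtain r1 r2 where r: "r1 \<in> R1" "r2 \<in> R2" "r = r1 + r2" using assms(6) by blast
      obtain c1 where c1: "r1 - (\<Sum>b\<in>B1. scale (c1 b) b) \<in> L1" using B1(3) r(1) by blast
      obtain c2 where c2: "r2 - (\<Sum>b\<in>B2. scale (c2 b) b) \<in> L2" using B2(3) r(2) by blast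
      have "(\<Sum>j\<in>J. scale (case_sum c1 c2 j) (base j)) =
          (\<Sum>b\<in>B1. scale (c1 b) b) + (\<Sum>b\<in>B2. scale (c2 b) b)"
        unfolding J_def using B1(1) B2(1) by (simp add: sum.Plus base_def o_def)
      then have "r = (r1 - (\<Sum>b\<in>B1. scale (c1 b) b)) + (r2 - (\<Sum>b\<in>B2. scale (c2 b) b)) +
          (\<Sum>j\<in>J. scale (case_sum c1 c2 j) (base j))"
        by (simp add: r(3))
      with c1 c2 show ?thesis by blast
    qed
    \<comment> \<open>\<open>M\<close> and \<open>N\<close> are arguments of \<open>rpow\<close>,
      hence one less than the exponents: D is the product of \<open>Suc M\<close> and
      \<open>Suc N\<close>.\<close>
    define M where "M = e * (k * di + 2) - 1"
    define N where "N = (t1 + t2) * (p - 1)"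
    have "rpow (lin a) (Suc M * Suc N - 1) = 0" for a :: "nat \<Rightarrow> 'r"
    proof -
      obtain l1 l2 c where a: "\<And>i. l1 i \<in> L1" "\<And>i. l2 i \<in> L2"
        "\<And>i. a i = l1 i + l2 i + (\<Sum>j\<in>J. scale (c i j) (base j))"
        using decomp[of "a _"] by metis
      define W where "W = (\<lambda>j. lin (\<lambda>i. c i j))"
      define z where "z = (\<Sum>j\<in>J. act scale (W j) (Sqfree (\<lambda>S. if S = {} then base j else 0)))"
      have split: "lin a = (lin l1 + lin l2) + z"
      proof (rule sqfree_eqI)
        fix S
        show "coeff (lin a) S = coeff (lin l1 + lin l2 + z) S"
          by (simp add: z_def W_def coeff_sum act_lin_const) (simp add: lin_def a(3))
      qed
      have v: "valued L1 (lin l1)" "valued L2 (lin l2)"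
        using a(1,2) L1(1) L2(1) by (auto intro: valued_lin)
      then have "valued R1 (lin l1)" "valued R2 (lin l2)"
        using assms(15,17) by (auto simp: valued_def)
      then have nil: "rpow (lin l1) (d1 - 1) = 0" "rpow (lin l2) (d2 - 1) = 0"
        by (blast intro: satisfies_symmetric_identity_rpow assms(9-12))+
      let ?g = "geo (lin l1) (d1 - 1) * geo (lin l2) (d2 - 1)"
      have vg: "valued L1 (geo (lin l1) (d1 - 1))" "valued L2 (geo (lin l2) (d2 - 1))"
        using valued_geo[OF L1 v(1)] valued_geo[OF L2 v(2)] by simp_all
      have "coeff (rpow ?g (k - 1)) S \<in> Ri" for S
        by (rule coeff_rpow_alternating[OF vg]) (use sub[OF di(2)] assms(13,21) in auto)
      moreover have "coeff (rpow ?g n) {} = 0" for n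
        using vg by (cases n) (simp_all add: coeff_mult valued_def)
      ultimately have "rpow (rpow ?g (k - 1)) (di - 1) = 0"
        using di by (intro satisfies_symmetric_identity_rpow) (auto simp: valued_def)
      then have g: "rpow ?g (k * di - 1) = 0"
        using di(1) assms(13) by (simp add: rpow_rpow)
      have "rpow (lin l1 + lin l2) M = 0"
      proof (rule rpow_add_eq_0[OF homogeneous_lin nil(1) homogeneous_lin nil(2) g])
        have "Suc (k * di - 1) = k * di" using di(1) assms(13) by simp
        moreover have "d1 - 1 + (d2 - 1) = e" using assms(9,10) by (simp add: e_def)
        \<comment> \<open>The bound is k di e, and M = k di e + 2 e - 1 is at least that because e >
          0.\<close>
        ultimately show "Suc (k * di - 1) * (d1 - 1 + (d2 - 1)) \<le> M"
          using False by (simp add: M_def algebra_simps)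
      qed
      moreover have "z \<in> filtration W J 1"
        unfolding z_def One_nat_def by (rule filtration_SucI) simp
      ultimately have "rpow (lin a) M \<in> filtration W J 1"
        using rpow_add_filtration[of z W J 1 "lin l1 + lin l2" M] by (simp only: split diff_zero)
      then have "rpow (rpow (lin a) M) N \<in> filtration W J (Suc N)"
        by (rule filtration_rpow)
      moreover have "rpow (W j) (p - 1) = 0" for j
        unfolding W_def using assms(2)
        by (intro satisfies_symmetric_identity_rpow[OF field_satisfies_symmetric_identity[OF assms(1,2)]]
            valued_lin) auto
      \<comment> \<open>With t1 + t2 scalars of p-th power 0, words of length above (t1 + t2)(p - 1)
        = N vanish, and \<open>Suc N\<close> is the first such length.\<close>
      ultimately have "rpow (rpow (lin a) M) N = 0"
        by (intro filtration_eq_0[OF J(1), of "p - 1" "Suc N" W]) (auto simp: J(2) N_def)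
      then show ?thesis by (simp only: rpow_rpow)
    qed
    moreover have "(d1 + d2 - 2) * (k * di + 2) * ((t1 + t2) * (p - 1) + 1) = Suc (Suc M * Suc N - 1)"
    proof -
      have "e * (k * di + 2) = Suc M" using False by (simp add: M_def)
      then show ?thesis by (simp add: N_def[symmetric] e_def[symmetric] del: One_nat_def) simp
    qed
    ultimately show ?thesis
      by (simp only: satisfies_symmetric_identityI)
  qed
qed

end
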